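(* Let $A:\hat\Sigma\to\mathbb{R}$ be a Hölder observable. Let $v$ be any continuous sub-action for $A$ and let $u$ be a continuous calibrated sub-action for $A$. 1. Then $u-v$ is constant on every irreducible component of $\Omega(A)$, and $\min_{\Sigma}(u-v)=\min_{\Omega(A)}(u-v)$. 2. Assume $\Omega(A)=\bigsqcup_{i=1}^r C_i$ is a finite union of disjoint irreducible components. If $\min_\Sigma(u-v)$ is realized on a unique component $C_{i_1}$ and the other components $C_i$, $i\neq i_1$, are not local minima for $u-v$, then $$u(\mathbf{x})=u(\bar{\mathbf{x}}_{i_1})+h_A(\bar{\mathbf{x}}_{i_1},\mathbf{x})\qquad\forall\,\mathbf{x}\in\Sigma,$$ where $\bar{\mathbf{x}}_{i_1}$ is any point of $C_{i_1}$.
   Context: Subshift. Let $\mathbf{M}$ be an irreducible $s\times s$ transition matrix with entries in $\{0,1\}$, let $\Sigma=\{\mathbf{x}=(x_0,x_1,\ldots)\in\{1,\ldots,s\}^{\mathbb{N}} : \mathbf{M}(x_j,x_{j+1})=1\ \forall j\ge 0\}$ be the associated one-sided transitive subshift of finite type, and let $\sigma(x_0,x_1,\ldots)=(x_1,x_2,\ldots)$. Fix $\lambda\in(0,1)$; $\Sigma$ carries the metric $d(\mathbf{x},\bar{\mathbf{x}})=\lambda^{k}$, $k=\min\{j:x_j\neq\bar x_j\}$ (and $d(\mathbf{x},\mathbf{x})=0$). Let $\Sigma^*=\{\mathbf{y}=(\ldots,y_2,y_1)\in\{1,\ldots,s\}^{\{1,2,\ldots\}} : \mathbf{M}(y_{j+1},y_j)=1\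 \forall j\ge1\}$ with the analogous metric. Put $\Sigma^*_{\mathbf{x}}=\{\mathbf{y}\in\Sigma^*:\mathbf{M}(y_1,x_0)=1\}$ and $\hat\Sigma=\{(\mathbf{y},\mathbf{x})\in\Sigma^*\times\Sigma:\mathbf{y}\in\Sigma^*_{\mathbf{x}}\}$, with the maximum metric. For $(\mathbf{y},\mathbf{x})\in\hat\Sigma$ put $\tau_{\mathbf{y}}(\mathbf{x})=(y_1,x_0,x_1,\ldots)\in\Sigma$. Holonomic minimizing value. $\hat{\mathcal{M}}_{\rm hol}$ is the set of Borel probability measures $\hat\mu$ on $\hat\Sigma$ with $\int f(\tau_{\mathbf{y}}(\mathbf{x}))\,d\hat\mu(\mathbf{y},\mathbf{x})=\int f(\mathbf{x})\,d\hat\mu(\mathbf{y},\mathbf{x})$ for all $f\in C^0(\Sigma)$. For an observable $A:\hat\Sigma\to\mathbb{R}$, $\bar A=\min\{\int A\,d\hat\mu:\hat\mu\in\hat{\mathcal{M}}_{\rm hol}\}$. Sub-actions. A sub-action for $A$ is a continuous $u:\Sigma\to\mathbb{R}$ with $u(\mathbf{x})-u(\tau_{\mathbf{y}}(\mathbf{x}))\le A(\mathbf{y},\mathbf{x})-\bar A$ for all $(\mathbf{y},\mathbf{x})\in\hat\Sigma$. It is calibrated if $u(\mathbf{x})=\min_{\mathbf{y}\in\Sigma^*_{\mathbf{x}}}[u(\tau_{\mathbf{y}}(\mathbf{x}))+A(\mathbf{y},\mathbf{x})-\bar A]$ for all $\mathbf{x}\in\Sigma$. Paths, non-wandering set, Peierls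 barrier. A path of length $k$ is a sequence $(\mathbf{z}^0,\ldots,\mathbf{z}^k)$ in $\hat\Sigma$, $\mathbf{z}^i=(\mathbf{y}^i,\mathbf{x}^i)$, with $\mathbf{x}^i=\tau_{\mathbf{y}^{i+1}}(\mathbf{x}^{i+1})$ for $0\le i\le k-1$. $\mathcal{P}_k(\mathbf{x},\bar{\mathbf{x}},\epsilon)$ is the set of paths of length $k$ with $d(\mathbf{x}^0,\mathbf{x})<\epsilon$ and $d(\mathbf{x}^k,\bar{\mathbf{x}})<\epsilon$. $\Omega(A)$ is the set of $\mathbf{x}\in\Sigma$ such that for every $\epsilon>0$ there are $k\ge1$ and $(\mathbf{z}^0,\ldots,\mathbf{z}^k)\in\mathcal{P}_k(\mathbf{x},\mathbf{x},\epsilon)$ with $\big|\sum_{i=1}^k(A-\bar A)(\mathbf{z}^i)\big|<\epsilon$. For $\epsilon>0$, $k\ge1$, let $S_A^\epsilon(\mathbf{x},\bar{\mathbf{x}},k)=\inf\{\sum_{i=1}^k(A-\bar A)(\mathbf{z}^i):(\mathbf{z}^0,\ldots,\mathbf{z}^k)\in\mathcal{P}_k(\mathbf{x},\bar{\mathbf{x}},\epsilon)\}$ ($\inf\emptyset=+\infty$). The Peierls barrier $h_A:\Sigma\times\Sigma\to\mathbb{R}\cup\{+\infty\}$ is $h_A(\mathbf{x},\bar{\mathbf{x}})=\lim_{\epsilon\to0}\liminf_{k\to+\infty}S_A^\epsilon(\mathbf{x},\bar{\mathbf{x}},k)$. Irreducible components. On $\Omega(A)$, the relation $\mathbf{x}\sim\bar{\mathbf{x}}\Leftrightarrow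 h_A(\mathbf{x},\bar{\mathbf{x}})+h_A(\bar{\mathbf{x}},\mathbf{x})=0$ is an equivalence relation; its equivalence classes are called irreducible components. Terminology. That a component $C_i$ (on which $u-v$ is constant, by item 1) is not a local minimum for $u-v$ means that every neighborhood of $C_i$ in $\Sigma$ contains a point $\mathbf{x}$ at which $u-v$ is strictly smaller than its value on $C_i$. *)

theory Defs
  imports "HOL-Probability.Probability"
begin

text \<open>
  The alphabet is a finite type \<open>'s\<close>, so \<open>s = CARD('s)\<close>.  A point \<open>y = (\<dots>, y\<^sub>2, y\<^sub>1)\<close> of the dual
  shift is the function \<open>nat \<Rightarrow> 's\<close> with \<open>y j\<close> standing for \<open>y\<^sub>j\<^sub>+\<^sub>1\<close>.
\<close>

definition transition_matrix :: "real^'s^'s \<Rightarrow> bool" where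
  "transition_matrix M \<longleftrightarrow> (\<forall>i j. M $ i $ j \<in> {0, 1})"

definition irreducible_matrix :: "real^'s^'s \<Rightarrow> bool" where
  "irreducible_matrix M \<longleftrightarrow> (\<forall>i j. \<exists>n\<ge>1. (((**) M ^^ n) (mat 1)) $ i $ j > 0)"

definition Sig :: "real^'s^'s \<Rightarrow> (nat \<Rightarrow> 's) set" where
  "Sig M = {x. \<forall>j. M $ x j $ x (Suc j) = 1}"

definition Sig_dual :: "real^'s^'s \<Rightarrow> (nat \<Rightarrow> 's) set" where
  "Sig_dual M = {y. \<forall>j. M $ y (Suc j) $ y j = 1}"

definition Sig_dual_at :: "real^'s^'s \<Rightarrow> (nat \<Rightarrow> 's) \<Rightarrow> (nat \<Rightarrow> 's) set" where
  "Sig_dual_at M x = {y \<in> Sig_dual M. M $ y 0 $ x 0 = 1}"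

definition Sig_hat :: "real^'s^'s \<Rightarrow> ((nat \<Rightarrow> 's) \<times> (nat \<Rightarrow> 's)) set" where
  "Sig_hat M = {(y, x). x \<in> Sig M \<and> y \<in> Sig_dual_at M x}"

definition tau :: "(nat \<Rightarrow> 's) \<Rightarrow> (nat \<Rightarrow> 's) \<Rightarrow> nat \<Rightarrow> 's" where
  "tau y x = case_nat (y 0) x"


subsection \<open>Metrics, topologies and regularity\<close>

definition dist_seq :: "real \<Rightarrow> (nat \<Rightarrow> 's) \<Rightarrow> (nat \<Rightarrow> 's) \<Rightarrow> real" where
  "dist_seq lam x x' = (if x = x' then 0 else lam ^ (LEAST j. x j \<noteq> x' j))"

text \<open>The exponent is shifted because the symbols of a dual point are numbered from 1.\<close>

definition dist_dual :: "real \<Rightarrow> (nat \<Rightarrow> 's) \<Rightarrow> (nat \<Rightarrow> 's) \<Rightarrow> real" where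
  "dist_dual lam y y' = (if y = y' then 0 else lam ^ Suc (LEAST j. y j \<noteq> y' j))"

definition dist_hat :: "real \<Rightarrow> (nat \<Rightarrow> 's) \<times> (nat \<Rightarrow> 's) \<Rightarrow> (nat \<Rightarrow> 's) \<times> (nat \<Rightarrow> 's) \<Rightarrow> real" where
  "dist_hat lam z z' = max (dist_dual lam (fst z) (fst z')) (dist_seq lam (snd z) (snd z'))"

lemma dist_seq_triangle:
  assumes "0 < lam" "lam < 1"
  shows "dist_seq lam x z \<le> max (dist_seq lam x y) (dist_seq lam y z)"
proof (cases "x = z \<or> x = y \<or> y = z")
  case True
  then show ?thesis using assms by (auto simp: dist_seq_def le_max_iff_disj)
next
  case False
  define k where "k = (LEAST j. x j \<noteq> z j)"
  have "\<exists>j. x j \<noteq> z j" using False by auto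
  then have "x k \<noteq> z k" unfolding k_def by (rule LeastI_ex)
  then consider "x k \<noteq> y k" | "y k \<noteq> z k" by metis
  then show ?thesis
  proof cases
    case 1
    then have "(LEAST j. x j \<noteq> y j) \<le> k" by (rule Least_le)
    then have "lam ^ k \<le> lam ^ (LEAST j. x j \<noteq> y j)"
      using assms by (intro power_decreasing) auto
    then show ?thesis using False by (simp add: dist_seq_def k_def le_max_iff_disj)
  next
    case 2
    then have "(LEAST j. y j \<noteq> z j) \<le> k" by (rule Least_le)
    then have "lam ^ k \<le> lam ^ (LEAST j. y j \<noteq> z j)"
      using assms by (intro power_decreasing) auto
    then show ?thesis using False by (simp add: dist_seq_def k_def le_max_iff_disj)
  qed
qed

lemma Metric_space_dist_seq:
  fixes S :: "(nat \<Rightarrow> 's) set"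
  assumes "0 < lam" "lam < 1"
  shows "Metric_space S (dist_seq lam)"
proof
  fix x y z :: "nat \<Rightarrow> 's"
  show nn: "0 \<le> dist_seq lam a b" for a b :: "nat \<Rightarrow> 's" using assms by (simp add: dist_seq_def)
  show "dist_seq lam x y = dist_seq lam y x" by (simp add: dist_seq_def eq_commute)
  show "dist_seq lam x y = 0 \<longleftrightarrow> x = y" using assms by (simp add: dist_seq_def)
  show "dist_seq lam x z \<le> dist_seq lam x y + dist_seq lam y z"
    using dist_seq_triangle[OF assms, of x z y] nn[of x y] nn[of y z] by linarith
qed

lemma dist_dual_eq: "dist_dual lam y y' = lam * dist_seq lam y y'"
  by (simp add: dist_dual_def dist_seq_def)

lemma Metric_space_dist_hat:
  fixes S :: "((nat \<Rightarrow> 's) \<times> (nat \<Rightarrow> 's)) set"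
  assumes "0 < lam" "lam < 1"
  shows "Metric_space S (dist_hat lam)"
proof -
  interpret D: Metric_space UNIV "dist_seq lam" by (rule Metric_space_dist_seq[OF assms])
  have tri: "lam * dist_seq lam a c \<le> lam * dist_seq lam a b + lam * dist_seq lam b c" for a b c :: "nat \<Rightarrow> 's"
    using D.triangle[of a b c] assms by (simp flip: distrib_left)
  show ?thesis
  proof
    fix x y z :: "(nat \<Rightarrow> 's) \<times> (nat \<Rightarrow> 's)"
    show "0 \<le> dist_hat lam x y" by (simp add: dist_hat_def le_max_iff_disj)
    show "dist_hat lam x y = dist_hat lam y x"
      by (simp add: dist_hat_def dist_dual_eq D.commute)
    have "max (lam * a) b = 0 \<longleftrightarrow> a = 0 \<and> b = 0" if "0 \<le> a" "0 \<le> b" for a b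
      using that assms by (auto simp: max_def mult_le_0_iff split: if_splits)
    then show "dist_hat lam x y = 0 \<longleftrightarrow> x = y"
      by (simp add: dist_hat_def dist_dual_eq prod_eq_iff)
    show "dist_hat lam x z \<le> dist_hat lam x y + dist_hat lam y z"
      using tri[of "fst x" "fst z" "fst y"] D.triangle[of "snd x" "snd y" "snd z"]
      unfolding dist_hat_def dist_dual_eq by (auto simp: max_def)
  qed
qed

definition top_Sig :: "real^'s^'s \<Rightarrow> real \<Rightarrow> (nat \<Rightarrow> 's) topology" where
  "top_Sig M lam = Metric_space.mtopology (Sig M) (dist_seq lam)"

definition top_Sig_hat :: "real^'s^'s \<Rightarrow> real \<Rightarrow> ((nat \<Rightarrow> 's) \<times> (nat \<Rightarrow> 's)) topology" where
  "top_Sig_hat M lam = Metric_space.mtopology (Sig_hat M) (dist_hat lam)"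

text \<open>
  Observables are functions of the pair \<open>(y, x)\<close>; only their values on \<open>Sig_hat M\<close> matter, and
  only the values on \<open>Sig M\<close> of functions of \<open>x\<close>.
\<close>

definition holder_observable ::
  "real^'s^'s \<Rightarrow> real \<Rightarrow> ((nat \<Rightarrow> 's) \<times> (nat \<Rightarrow> 's) \<Rightarrow> real) \<Rightarrow> bool" where
  "holder_observable M lam A \<longleftrightarrow>
     (\<exists>K \<alpha>. 0 < \<alpha> \<and> (\<forall>z\<in>Sig_hat M. \<forall>z'\<in>Sig_hat M. \<bar>A z - A z'\<bar> \<le> K * dist_hat lam z z' powr \<alpha>))"

definition has_min_on :: "('a \<Rightarrow> real) \<Rightarrow> 'a set \<Rightarrow> real \<Rightarrow> bool" where
  "has_min_on f S m \<longleftrightarrow> m \<in> f ` S \<and> (\<forall>x\<in>S. m \<le> f x)"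


subsection \<open>Holonomic measures and sub-actions\<close>

definition holonomic_measures ::
  "real^'s^'s \<Rightarrow> real \<Rightarrow> ((nat \<Rightarrow> 's) \<times> (nat \<Rightarrow> 's)) measure set" where
  "holonomic_measures M lam =
     {\<mu>. prob_space \<mu> \<and> space \<mu> = Sig_hat M \<and>
         sets \<mu> = sigma_sets (Sig_hat M) {U. openin (top_Sig_hat M lam) U} \<and>
         (\<forall>f. continuous_map (top_Sig M lam) euclideanreal f \<longrightarrow>
            (\<integral>z. f (tau (fst z) (snd z)) \<partial>\<mu>) = (\<integral>z. f (snd z) \<partial>\<mu>))}"

text \<open>
  For a continuous observable the infimum is a minimum, since the set of holonomic measures is
  nonempty and weak-* compact.
\<close>

definition min_value :: "real^'s^'s \<Rightarrow> real \<Rightarrow> ((nat \<Rightarrow> 's) \<times> (nat \<Rightarrow> 's) \<Rightarrow> real) \<Rightarrow> real" where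
  "min_value M lam A = (INF \<mu>\<in>holonomic_measures M lam. \<integral>z. A z \<partial>\<mu>)"

definition sub_action ::
  "real^'s^'s \<Rightarrow> real \<Rightarrow> ((nat \<Rightarrow> 's) \<times> (nat \<Rightarrow> 's) \<Rightarrow> real) \<Rightarrow> ((nat \<Rightarrow> 's) \<Rightarrow> real) \<Rightarrow> bool" where
  "sub_action M lam A u \<longleftrightarrow>
     continuous_map (top_Sig M lam) euclideanreal u \<and>
     (\<forall>(y, x)\<in>Sig_hat M. u x - u (tau y x) \<le> A (y, x) - min_value M lam A)"

definition calibrated_sub_action ::
  "real^'s^'s \<Rightarrow> real \<Rightarrow> ((nat \<Rightarrow> 's) \<times> (nat \<Rightarrow> 's) \<Rightarrow> real) \<Rightarrow> ((nat \<Rightarrow> 's) \<Rightarrow> real) \<Rightarrow> bool" where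
  "calibrated_sub_action M lam A u \<longleftrightarrow>
     sub_action M lam A u \<and>
     (\<forall>x\<in>Sig M.
        has_min_on (\<lambda>y. u (tau y x) + A (y, x) - min_value M lam A) (Sig_dual_at M x) (u x))"


subsection \<open>Paths, the non-wandering set and the Peierls barrier\<close>

text \<open>A path of length \<open>k\<close> is given by the values at \<open>0, \<dots>, k\<close> of a function on \<open>nat\<close>.\<close>

definition is_path :: "real^'s^'s \<Rightarrow> nat \<Rightarrow> (nat \<Rightarrow> (nat \<Rightarrow> 's) \<times> (nat \<Rightarrow> 's)) \<Rightarrow> bool" where
  "is_path M k z \<longleftrightarrow>
     (\<forall>i\<le>k. z i \<in> Sig_hat M) \<and>
     (\<forall>i<k. snd (z i) = tau (fst (z (Suc i))) (snd (z (Suc i))))"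

definition paths ::
  "real^'s^'s \<Rightarrow> real \<Rightarrow> nat \<Rightarrow> (nat \<Rightarrow> 's) \<Rightarrow> (nat \<Rightarrow> 's) \<Rightarrow> real
     \<Rightarrow> (nat \<Rightarrow> (nat \<Rightarrow> 's) \<times> (nat \<Rightarrow> 's)) set" where
  "paths M lam k x x' \<epsilon> =
     {z. is_path M k z \<and> dist_seq lam (snd (z 0)) x < \<epsilon> \<and> dist_seq lam (snd (z k)) x' < \<epsilon>}"

definition path_cost ::
  "real^'s^'s \<Rightarrow> real \<Rightarrow> ((nat \<Rightarrow> 's) \<times> (nat \<Rightarrow> 's) \<Rightarrow> real) \<Rightarrow> nat
     \<Rightarrow> (nat \<Rightarrow> (nat \<Rightarrow> 's) \<times> (nat \<Rightarrow> 's)) \<Rightarrow> real" where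
  "path_cost M lam A k z = (\<Sum>i=1..k. A (z i) - min_value M lam A)"

definition nonwandering ::
  "real^'s^'s \<Rightarrow> real \<Rightarrow> ((nat \<Rightarrow> 's) \<times> (nat \<Rightarrow> 's) \<Rightarrow> real) \<Rightarrow> (nat \<Rightarrow> 's) set" where
  "nonwandering M lam A =
     {x \<in> Sig M. \<forall>\<epsilon>>0. \<exists>k\<ge>1. \<exists>z\<in>paths M lam k x x \<epsilon>. \<bar>path_cost M lam A k z\<bar> < \<epsilon>}"

definition min_cost ::
  "real^'s^'s \<Rightarrow> real \<Rightarrow> ((nat \<Rightarrow> 's) \<times> (nat \<Rightarrow> 's) \<Rightarrow> real) \<Rightarrow> real
     \<Rightarrow> (nat \<Rightarrow> 's) \<Rightarrow> (nat \<Rightarrow> 's) \<Rightarrow> nat \<Rightarrow> ereal" where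
  "min_cost M lam A \<epsilon> x x' k = (INF z\<in>paths M lam k x x' \<epsilon>. ereal (path_cost M lam A k z))"

text \<open>The limit exists because \<open>min_cost\<close> increases as \<open>\<epsilon>\<close> decreases.\<close>

definition peierls ::
  "real^'s^'s \<Rightarrow> real \<Rightarrow> ((nat \<Rightarrow> 's) \<times> (nat \<Rightarrow> 's) \<Rightarrow> real)
     \<Rightarrow> (nat \<Rightarrow> 's) \<Rightarrow> (nat \<Rightarrow> 's) \<Rightarrow> ereal" where
  "peierls M lam A x x' = Lim (at_right 0) (\<lambda>\<epsilon>. liminf (min_cost M lam A \<epsilon> x x'))"

definition irreducible_components ::
  "real^'s^'s \<Rightarrow> real \<Rightarrow> ((nat \<Rightarrow> 's) \<times> (nat \<Rightarrow> 's) \<Rightarrow> real) \<Rightarrow> (nat \<Rightarrow> 's) set set" where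
  "irreducible_components M lam A =
     nonwandering M lam A //
       {(x, x'). x \<in> nonwandering M lam A \<and> x' \<in> nonwandering M lam A \<and>
                 peierls M lam A x x' + peierls M lam A x' x = 0}"

definition not_local_min ::
  "real^'s^'s \<Rightarrow> real \<Rightarrow> ((nat \<Rightarrow> 's) \<Rightarrow> real) \<Rightarrow> (nat \<Rightarrow> 's) set \<Rightarrow> bool" where
  "not_local_min M lam w C \<longleftrightarrow>
     (\<forall>U. openin (top_Sig M lam) U \<and> C \<subseteq> U \<longrightarrow> (\<exists>x\<in>U. \<forall>c\<in>C. w x < w c))"

end

(* By telescoping along paths, every sub-action u satisfies h_A(a,b) >= u(b) - u(a). If
   h_A(a,b) + h_A(b,a) = 0, this is an equality for both u and v, hence u - v has the same
   value at a and b. For calibrated u, each x has a backward orbit along which u realizes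
   the cost and u - v does not increase. Its accumulation points p lie in Omega(A), satisfy
   (u - v)(p) <= (u - v)(x), and h_A(p,x) = u(x) - u(p). The relation "h_A(a,b) = u(b) - u(a)" is
   closed under limits, and transitive because Hoelder continuity bounds the error made in
   splicing paths, so for item 2 it suffices to connect the minimizing component to all of
   Omega(A), which is an induction on the values of u - v. *)

theory Submission
  imports Defs "HOL-Complex_Analysis.Great_Picard"
begin

section \<open>Finite agreement of sequences, subsequence limits and the metric\<close>

definition agree :: "nat \<Rightarrow> (nat \<Rightarrow> 'a) \<Rightarrow> (nat \<Rightarrow> 'a) \<Rightarrow> bool" where
  "agree n x y \<longleftrightarrow> (\<forall>j<n. x j = y j)"

lemma agree_sym: "agree n x y \<Longrightarrow> agree n y x"
  by (simp add: agree_def)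

lemma agree_trans: "agree n x y \<Longrightarrow> agree n y z \<Longrightarrow> agree n x z"
  by (simp add: agree_def)

lemma agree_mono: "agree n x y \<Longrightarrow> m \<le> n \<Longrightarrow> agree m x y"
  by (simp add: agree_def)

text \<open>Convergence in a product of discrete alphabets. Phrased through \<open>agree\<close>, it
  turns limit arguments into statements about finite prefixes.\<close>

definition tends_seq :: "(nat \<Rightarrow> nat \<Rightarrow> 'a) \<Rightarrow> (nat \<Rightarrow> 'a) \<Rightarrow> bool" where
  "tends_seq X p \<longleftrightarrow> (\<forall>N. \<forall>\<^sub>F n in sequentially. agree N (X n) p)"

text \<open>Coding the symbols by naturals gives uniformly bounded real functions on the countable
  set of positions. A diagonal argument makes a subsequence converge at every position, and a
  convergent sequence of integers is eventually constant.\<close>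

lemma convergent_subsequence:
  fixes X :: "nat \<Rightarrow> nat \<Rightarrow> 's::finite"
  obtains r p where "strict_mono (r::nat\<Rightarrow>nat)" "tends_seq (\<lambda>n. X (r n)) p"
proof -
  define e :: "'s \<Rightarrow> nat" where "e = to_nat_on UNIV"
  have inje: "inj e" unfolding e_def by (intro inj_on_to_nat_on countable_finite) auto
  have b: "norm (real (e (X n j))) \<le> real (Max (range e))" for n j
    by simp
  obtain r :: "nat \<Rightarrow> nat" where r: "strict_mono r"
    and l: "\<And>j. \<exists>l. (\<lambda>n. real (e (X (r n) j))) \<longlonglongrightarrow> l"
    using function_convergent_subsequence[of UNIV "\<lambda>n j. real (e (X n j))" "real (Max (range e))"] b
    by auto
  have "\<exists>a. \<forall>\<^sub>F n in sequentially. X (r n) j = a" for j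
  proof -
    from l obtain l where "(\<lambda>n. real (e (X (r n) j))) \<longlonglongrightarrow> l" by blast
    then have "Cauchy (\<lambda>n. real (e (X (r n) j)))" by (rule LIMSEQ_imp_Cauchy)
    then obtain N where N: "\<And>m n. m \<ge> N \<Longrightarrow> n \<ge> N \<Longrightarrow>
        dist (real (e (X (r m) j))) (real (e (X (r n) j))) < 1"
      by (meson Cauchy_def zero_less_one)
    have "X (r n) j = X (r N) j" if "n \<ge> N" for n
    proof -
      have "e (X (r n) j) = e (X (r N) j)" using N[OF that, of N] by (auto simp: dist_real_def)
      with inje show ?thesis by (simp add: inj_eq)
    qed
    then show ?thesis unfolding eventually_sequentially by blast
  qed
  then obtain p where p: "\<And>j. \<forall>\<^sub>F n in sequentially. X (r n) j = p j" by metis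
  have "tends_seq (\<lambda>n. X (r n)) p"
    unfolding tends_seq_def agree_def
  proof
    fix N :: nat
    have "\<forall>\<^sub>F n in sequentially. \<forall>j\<in>{..<N}. X (r n) j = p j"
      by (rule eventually_ball_finite) (use p in auto)
    then show "\<forall>\<^sub>F n in sequentially. \<forall>j<N. X (r n) j = p j"
      by (rule eventually_mono) simp
  qed
  with r show thesis by (rule that)
qed

lemma Sig_closed:
  assumes "\<And>n. X n \<in> Sig M" "tends_seq X p"
  shows "p \<in> Sig M"
  unfolding Sig_def
proof (intro CollectI allI)
  fix j
  from assms(2) have "\<forall>\<^sub>F n in sequentially. agree (Suc (Suc j)) (X n) p"
    by (simp add: tends_seq_def)
  then obtain n where "agree (Suc (Suc j)) (X n) p" by (auto simp: eventually_sequentially)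
  then have "X n j = p j" "X n (Suc j) = p (Suc j)" by (auto simp: agree_def)
  moreover have "M $ X n j $ X n (Suc j) = 1" using assms(1)[of n] by (simp add: Sig_def)
  ultimately show "M $ p j $ p (Suc j) = 1" by simp
qed

text \<open>If row \<open>i\<close> of \<open>M\<close> vanished, so would row \<open>i\<close> of
  every positive power of \<open>M\<close>, against the positive diagonal entry.\<close>

lemma irreducible_row_nonzero:
  fixes M :: "real^'s^'s"
  assumes "irreducible_matrix M"
  shows "\<exists>j. M $ i $ j \<noteq> 0"
proof (rule ccontr)
  assume "\<not> ?thesis"
  then have z: "M $ i $ j = 0" for j by auto
  from assms obtain n where "n \<ge> 1" "(((**) M ^^ n) (mat 1)) $ i $ i > 0"
    unfolding irreducible_matrix_def by blast
  moreover from \<open>n \<ge> 1\<close> obtain m where "n = Suc m" by (cases n) auto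
  ultimately show False by (simp add: matrix_matrix_mult_def z)
qed

lemma Sig_nonempty:
  fixes M :: "real^'s^'s"
  assumes "transition_matrix M" "irreducible_matrix M"
  shows "Sig M \<noteq> {}"
proof -
  have "\<exists>j. M $ i $ j = 1" for i
    using irreducible_row_nonzero[OF assms(2), of i] assms(1)
    unfolding transition_matrix_def by blast
  then obtain f where f: "\<And>i. M $ i $ f i = 1" by metis
  have "(\<lambda>n. (f ^^ n) undefined) \<in> Sig M" by (simp add: Sig_def f)
  then show ?thesis by blast
qed

lemma tau_in_Sig: "(y, x) \<in> Sig_hat M \<Longrightarrow> tau y x \<in> Sig M"
  by (auto simp: Sig_hat_def Sig_dual_at_def Sig_def tau_def split: nat.split)

text \<open>The strict inequality says that the first difference comes after position
  \<open>n\<close>, hence agreement on the \<open>n + 1\<close> symbols at 0 to \<open>n\<close>.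
  For the weak bound in \<open>dist_seq_le_power\<close>, agreement on \<open>n\<close> symbols is
  enough.\<close>

lemma dist_seq_less_power_iff:
  assumes "0 < lam" "lam < 1"
  shows "dist_seq lam x y < lam ^ n \<longleftrightarrow> agree (Suc n) x y"
proof (cases "x = y")
  case True
  then show ?thesis using assms by (simp add: dist_seq_def agree_def)
next
  case False
  define k where "k = (LEAST j. x j \<noteq> y j)"
  have "\<exists>j. x j \<noteq> y j" using False by auto
  then have k: "x k \<noteq> y k" unfolding k_def by (rule LeastI_ex)
  have "lam ^ k < lam ^ n \<longleftrightarrow> n < k" using assms by simp
  moreover have "n < k \<longleftrightarrow> agree (Suc n) x y"
    using k not_less_Least[of _ "\<lambda>j. x j \<noteq> y j"] unfolding agree_def k_def[symmetric]
    by (metis less_Suc_eq_le not_le order_le_less_trans)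
  ultimately show ?thesis using False by (simp add: dist_seq_def k_def)
qed

lemma dist_seq_le_power:
  assumes "0 < lam" "lam < 1" "agree n x y"
  shows "dist_seq lam x y \<le> lam ^ n"
proof (cases "x = y")
  case False
  define k where "k = (LEAST j. x j \<noteq> y j)"
  have "\<exists>j. x j \<noteq> y j" using False by auto
  then have "x k \<noteq> y k" unfolding k_def by (rule LeastI_ex)
  then have "n \<le> k" using assms(3) by (meson agree_def not_le)
  then show ?thesis using False assms by (simp add: dist_seq_def k_def power_decreasing)
qed (use assms in \<open>simp add: dist_seq_def\<close>)

lemma dist_seq_less_ex_agree:
  assumes "0 < lam" "lam < 1" "0 < e"
  obtains n where "\<And>x y :: nat \<Rightarrow> 'a. agree n x y \<Longrightarrow> dist_seq lam x y < e"
proof -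
  obtain n where "lam ^ n < e" using real_arch_pow_inv[of e lam] assms by blast
  then show thesis
    by (intro that[of n] le_less_trans[OF dist_seq_le_power[OF assms(1,2)]])
qed


section \<open>The subshift and its paths\<close>

locale observable =
  fixes M :: "real^'s^'s"
    and lam :: real
    and A :: "(nat \<Rightarrow> 's) \<times> (nat \<Rightarrow> 's) \<Rightarrow> real"
  assumes lam_pos: "0 < lam" and lam_less: "lam < 1"
begin

sublocale Metric_space "Sig M" "dist_seq lam"
  by (rule Metric_space_dist_seq[OF lam_pos lam_less])

lemma continuous_agree:
  assumes "continuous_map (top_Sig M lam) euclideanreal f" "a \<in> Sig M" "0 < e"
  obtains n where "\<And>x. x \<in> Sig M \<Longrightarrow> agree n x a \<Longrightarrow> \<bar>f x - f a\<bar> < e"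
proof -
  let ?U = "{x \<in> Sig M. f x \<in> ball (f a) e}"
  have "openin mtopology ?U"
    using assms(1) openin_continuous_map_preimage[of mtopology euclideanreal f "ball (f a) e"]
    by (simp add: top_Sig_def)
  then obtain r where r: "r > 0" "mball a r \<subseteq> ?U"
    using assms(2,3) unfolding openin_mtopology by force
  obtain n where n: "\<And>x y :: nat \<Rightarrow> 's. agree n x y \<Longrightarrow> dist_seq lam x y < r"
    using dist_seq_less_ex_agree[OF lam_pos lam_less r(1)] by blast
  show thesis
  proof (rule that)
    fix x assume "x \<in> Sig M" "agree n x a"
    then have "x \<in> mball a r" using n assms(2) by (simp add: commute[of a])
    then show "\<bar>f x - f a\<bar> < e" using r(2) by (force simp: dist_real_def)
  qed
qed

lemma continuous_tends_seq:
  assumes "continuous_map (top_Sig M lam) euclideanreal f"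
    "\<And>n. X n \<in> Sig M" "tends_seq X p"
  shows "(\<lambda>n. f (X n)) \<longlonglongrightarrow> f p"
proof (rule tendstoI)
  fix e :: real assume "e > 0"
  then obtain N where N: "\<And>x. x \<in> Sig M \<Longrightarrow> agree N x p \<Longrightarrow> \<bar>f x - f p\<bar> < e"
    using continuous_agree[OF assms(1) Sig_closed[OF assms(2,3)]] by blast
  have "\<forall>\<^sub>F n in sequentially. agree N (X n) p" using assms(3) by (simp add: tends_seq_def)
  then show "\<forall>\<^sub>F n in sequentially. dist (f (X n)) (f p) < e"
    by eventually_elim (use N assms(2) in \<open>simp add: dist_real_def\<close>)
qed

lemma compactin_Sig: "compactin mtopology (Sig M)"
  unfolding compactin_sequentially
proof (intro conjI allI impI)
  fix X :: "nat \<Rightarrow> nat \<Rightarrow> 's" assume X: "range X \<subseteq> Sig M"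
  obtain r p where r: "strict_mono (r::nat\<Rightarrow>nat)" "tends_seq (\<lambda>n. X (r n)) p"
    by (rule convergent_subsequence)
  have Xr: "X (r n) \<in> Sig M" for n using X by auto
  have p: "p \<in> Sig M" using Sig_closed[of "\<lambda>n. X (r n)"] Xr r(2) by blast
  have "limitin mtopology (X \<circ> r) p sequentially"
    unfolding limitin_metric
  proof (intro conjI allI impI)
    fix e :: real assume "e > 0"
    then obtain N where N: "\<And>x y :: nat \<Rightarrow> 's. agree N x y \<Longrightarrow> dist_seq lam x y < e"
      using dist_seq_less_ex_agree[OF lam_pos lam_less] by blast
    have "\<forall>\<^sub>F n in sequentially. agree N (X (r n)) p" using r(2) by (simp add: tends_seq_def)
    then show "\<forall>\<^sub>F n in sequentially. (X \<circ> r) n \<in> Sig M \<and> dist_seq lam ((X \<circ> r) n) p < e"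
      by eventually_elim (use N Xr in simp)
  qed (rule p)
  with p r(1) show "\<exists>l r. l \<in> Sig M \<and> strict_mono r \<and> limitin mtopology (X \<circ> r) l sequentially"
    by blast
qed simp

lemma continuous_attains_min:
  assumes "continuous_map (top_Sig M lam) euclideanreal f" "Sig M \<noteq> {}"
  obtains x where "x \<in> Sig M" "\<And>y. y \<in> Sig M \<Longrightarrow> f x \<le> f y"
proof -
  have "compact (f ` Sig M)"
    using image_compactin[OF compactin_Sig, of euclideanreal f] assms(1) by (simp add: top_Sig_def)
  then show thesis using compact_attains_inf[of "f ` Sig M"] assms(2) that by auto
qed

lemma is_path_in_Sig: "is_path M k z \<Longrightarrow> i \<le> k \<Longrightarrow> snd (z i) \<in> Sig M"
  unfolding is_path_def Sig_hat_def by force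

text \<open>Lowering the path index by one prepends one symbol, so deleting the first
  \<open>m\<close> symbols at index \<open>i\<close> gives the point at index
  \<open>i + m\<close>.\<close>

lemma is_path_shift:
  assumes "is_path M k z" "i + m \<le> k"
  shows "snd (z i) (m + j) = snd (z (i + m)) j"
  using assms(2)
proof (induction m arbitrary: j)
  case (Suc m)
  have "snd (z i) (Suc m + j) = snd (z (i + m)) (Suc j)" using Suc.IH[of "Suc j"] Suc.prems by simp
  also have "snd (z (i + m)) = tau (fst (z (Suc (i + m)))) (snd (z (Suc (i + m))))"
    using assms(1) Suc.prems by (simp add: is_path_def)
  finally show ?case by (simp add: tau_def)
qed simp

lemma sub_action_path_cost:
  assumes "sub_action M lam A u" "is_path M k z"
  shows "u (snd (z k)) - u (snd (z 0)) \<le> path_cost M lam A k z"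
proof -
  have "i \<le> k \<Longrightarrow> u (snd (z i)) - u (snd (z 0)) \<le> path_cost M lam A i z" for i
  proof (induction i)
    case (Suc i)
    have "z (Suc i) \<in> Sig_hat M" "snd (z i) = tau (fst (z (Suc i))) (snd (z (Suc i)))"
      using assms(2) Suc.prems by (auto simp: is_path_def)
    then have "u (snd (z (Suc i))) - u (snd (z i)) \<le> A (z (Suc i)) - min_value M lam A"
      using assms(1) by (force simp: sub_action_def)
    then show ?case using Suc by (simp add: path_cost_def)
  qed (simp add: path_cost_def)
  then show ?thesis by simp
qed

section \<open>The Peierls barrier as a supremum, and its lower bound by sub-actions\<close>

definition barrier_at :: "(nat \<Rightarrow> 's) \<Rightarrow> (nat \<Rightarrow> 's) \<Rightarrow> real \<Rightarrow> ereal" where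
  "barrier_at a b e = liminf (min_cost M lam A e a b)"

lemma paths_mono: "e \<le> e' \<Longrightarrow> paths M lam k a b e \<subseteq> paths M lam k a b e'"
  by (auto simp: paths_def)

lemma barrier_at_antimono: "e \<le> e' \<Longrightarrow> barrier_at a b e' \<le> barrier_at a b e"
  unfolding barrier_at_def min_cost_def
  by (intro Liminf_mono always_eventually allI INF_superset_mono paths_mono) auto

text \<open>Shrinking \<open>e\<close> leaves fewer paths, so \<open>barrier_at a b\<close> grows
  and its limit at 0 is a supremum. A single \<open>e\<close> then gives lower bounds for the
  barrier, and an estimate for all \<open>e\<close> gives upper ones.\<close>

lemma peierls_eq_SUP: "peierls M lam A a b = (SUP e\<in>{0<..}. barrier_at a b e)"
proof -
  have "(barrier_at a b \<longlongrightarrow> (SUP e\<in>{0<..}. barrier_at a b e)) (at_right 0)"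
  proof (rule order_tendstoI)
    fix c assume "c < (SUP e\<in>{0<..}. barrier_at a b e)"
    then obtain e where e: "e > 0" "c < barrier_at a b e" by (auto simp: less_SUP_iff)
    have "\<forall>\<^sub>F d in at_right 0. d \<in> {0<..<e}" using e(1) by (rule eventually_at_right_real)
    then show "\<forall>\<^sub>F d in at_right 0. c < barrier_at a b d"
    proof eventually_elim
      case (elim d)
      then have "barrier_at a b e \<le> barrier_at a b d" by (intro barrier_at_antimono) simp
      with e(2) show ?case by (rule less_le_trans)
    qed
  next
    fix c assume c: "(SUP e\<in>{0<..}. barrier_at a b e) < c"
    have "\<forall>\<^sub>F d in at_right 0. d \<in> {0<..<1::real}" by (rule eventually_at_right_real) simp
    then show "\<forall>\<^sub>F d in at_right 0. barrier_at a b d < c"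
    proof eventually_elim
      case (elim d)
      then have "barrier_at a b d \<le> (SUP e\<in>{0<..}. barrier_at a b e)" by (intro SUP_upper) simp
      then show ?case using c by (rule le_less_trans)
    qed
  qed
  then show ?thesis
    unfolding peierls_def barrier_at_def[symmetric] by (intro tendsto_Lim) simp_all
qed

lemma sub_action_le_peierls:
  assumes u: "sub_action M lam A u" and ab: "a \<in> Sig M" "b \<in> Sig M"
  shows "ereal (u b - u a) \<le> peierls M lam A a b"
proof (rule ereal_le_epsilon2)
  show "ereal (u b - u a) \<le> peierls M lam A a b + ereal e" if e: "0 < e" for e
  proof -
    have cont: "continuous_map (top_Sig M lam) euclideanreal u" using u by (simp add: sub_action_def)
    obtain m where m: "\<And>x. x \<in> Sig M \<Longrightarrow> agree m x a \<Longrightarrow> \<bar>u x - u a\<bar> < e / 2"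
      using continuous_agree[OF cont ab(1), of "e / 2"] e by auto
    obtain n where n: "\<And>x. x \<in> Sig M \<Longrightarrow> agree n x b \<Longrightarrow> \<bar>u x - u b\<bar> < e / 2"
      using continuous_agree[OF cont ab(2), of "e / 2"] e by auto
    \<comment> \<open>Points within this distance of \<open>a\<close> and \<open>b\<close> share
      more than \<open>max m n\<close> symbols with them, so replacing the ends of a path by
      \<open>a\<close> and \<open>b\<close> changes \<open>u\<close> by less than
      \<open>e / 2\<close> each.\<close>
    define d where "d = lam ^ max m n"
    have d: "d > 0" using lam_pos by (simp add: d_def)
    have "u b - u a - e \<le> path_cost M lam A k z" if "z \<in> paths M lam k a b d" for k z
    proof -
      have p: "is_path M k z" and "agree (Suc (max m n)) (snd (z 0)) a"
        "agree (Suc (max m n)) (snd (z k)) b"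
        using that unfolding paths_def d_def dist_seq_less_power_iff[OF lam_pos lam_less] by auto
      then have "agree m (snd (z 0)) a" "agree n (snd (z k)) b" by (auto elim!: agree_mono)
      then have "\<bar>u (snd (z 0)) - u a\<bar> < e / 2" "\<bar>u (snd (z k)) - u b\<bar> < e / 2"
        using m n is_path_in_Sig[OF p] by auto
      with sub_action_path_cost[OF u p] show ?thesis by linarith
    qed
    then have "ereal (u b - u a - e) \<le> barrier_at a b d"
      unfolding barrier_at_def min_cost_def
      by (intro Liminf_bounded always_eventually allI INF_greatest) simp
    also have "\<dots> \<le> peierls M lam A a b"
      unfolding peierls_eq_SUP using d by (intro SUP_upper) simp
    finally show "ereal (u b - u a) \<le> peierls M lam A a b + ereal e"
      by (cases "peierls M lam A a b") auto
  qed
qed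


section \<open>Points joined by calibrated paths\<close>

text \<open>Expresses through single paths that the barrier from \<open>a\<close> to
  \<open>b\<close> is at most \<open>u b - u a\<close>. One integer \<open>N\<close> controls both
  the closeness of the ends and the length of the path, replacing the two limits in the
  barrier.\<close>

definition joins :: "((nat \<Rightarrow> 's) \<Rightarrow> real) \<Rightarrow> (nat \<Rightarrow> 's) \<Rightarrow> (nat \<Rightarrow> 's) \<Rightarrow> bool" where
  "joins u a b \<longleftrightarrow> (\<forall>e>0. \<forall>N. \<exists>k\<ge>N. \<exists>z. is_path M k z \<and> agree N (snd (z 0)) a \<and>
     agree N (snd (z k)) b \<and> path_cost M lam A k z < u b - u a + e)"

lemma joinsD:
  assumes "joins u a b" "0 < e"
  obtains k z where "N \<le> k" "is_path M k z" "agree N (snd (z 0)) a" "agree N (snd (z k)) b"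
    "path_cost M lam A k z < u b - u a + e"
  using assms unfolding joins_def by blast

text \<open>If the lower limit exceeded the bound, all long paths near the two points would be
  expensive, but \<open>joins\<close> supplies arbitrarily long cheap ones. Conversely, a lower
  limit below the bound at radius \<open>lam ^ N\<close> leaves a cheap path of length at least
  \<open>N\<close>.\<close>

lemma joins_iff_peierls_le: "joins u a b \<longleftrightarrow> peierls M lam A a b \<le> ereal (u b - u a)"
proof
  assume G: "joins u a b"
  have "barrier_at a b d \<le> ereal (u b - u a)" if d: "d > 0" for d
  proof (rule ereal_le_epsilon2)
    fix e :: real assume e: "0 < e"
    obtain n where n: "\<And>x y :: nat \<Rightarrow> 's. agree n x y \<Longrightarrow> dist_seq lam x y < d"
      using dist_seq_less_ex_agree[OF lam_pos lam_less d] by blast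
    show "barrier_at a b d \<le> ereal (u b - u a) + ereal e"
    proof (rule ccontr)
      assume "\<not> ?thesis"
      then have "ereal (u b - u a + e) < liminf (min_cost M lam A d a b)"
        by (simp add: barrier_at_def)
      then have "\<forall>\<^sub>F k in sequentially. ereal (u b - u a + e) < min_cost M lam A d a b k"
        by (rule less_LiminfD)
      then obtain m where m: "\<And>k. k \<ge> m \<Longrightarrow> ereal (u b - u a + e) < min_cost M lam A d a b k"
        by (auto simp: eventually_sequentially)
      obtain k z where z: "max m n \<le> k" "is_path M k z" "agree (max m n) (snd (z 0)) a"
        "agree (max m n) (snd (z k)) b" "path_cost M lam A k z < u b - u a + e"
        using joinsD[OF G e] by blast
      have "agree n (snd (z 0)) a" "agree n (snd (z k)) b"
        using z(3,4) by (auto intro: agree_mono)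
      then have "z \<in> paths M lam k a b d" using z(2) n by (simp add: paths_def)
      then have "min_cost M lam A d a b k \<le> ereal (path_cost M lam A k z)"
        unfolding min_cost_def by (rule INF_lower)
      then have "ereal (u b - u a + e) < ereal (path_cost M lam A k z)"
        using m[of k] z(1) by (meson less_le_trans max.boundedE)
      with z(5) show False by simp
    qed
  qed
  then show "peierls M lam A a b \<le> ereal (u b - u a)"
    unfolding peierls_eq_SUP by (intro SUP_least) simp
next
  assume P: "peierls M lam A a b \<le> ereal (u b - u a)"
  show "joins u a b"
    unfolding joins_def
  proof (intro allI impI)
    fix e :: real and N :: nat
    assume e: "0 < e"
    define d where "d = lam ^ N"
    have "d > 0" using lam_pos by (simp add: d_def)
    then have "barrier_at a b d \<le> ereal (u b - u a)"
      using P SUP_upper[of d "{0<..}" "barrier_at a b"] unfolding peierls_eq_SUP by auto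
    then have "liminf (min_cost M lam A d a b) < ereal (u b - u a + e)"
      using e by (auto simp: barrier_at_def intro: le_less_trans)
    then have "\<not> (\<forall>\<^sub>F k in sequentially. ereal (u b - u a + e) \<le> min_cost M lam A d a b k)"
      by (metis Liminf_bounded not_le)
    then obtain k where "k \<ge> N" "min_cost M lam A d a b k < ereal (u b - u a + e)"
      unfolding eventually_sequentially by (meson not_le)
    then obtain z where "z \<in> paths M lam k a b d" "path_cost M lam A k z < u b - u a + e"
      by (auto simp: min_cost_def INF_less_iff)
    then have "is_path M k z \<and> agree N (snd (z 0)) a \<and> agree N (snd (z k)) b \<and>
        path_cost M lam A k z < u b - u a + e"
      by (auto simp: paths_def d_def dist_seq_less_power_iff[OF lam_pos lam_less] elim: agree_mono)
    with \<open>k \<ge> N\<close> show "\<exists>k\<ge>N. \<exists>z. is_path M k z \<and> agree N (snd (z 0)) a \<and>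
        agree N (snd (z k)) b \<and> path_cost M lam A k z < u b - u a + e"
      by blast
  qed
qed

lemma joins_peierls_eq:
  assumes "sub_action M lam A u" "a \<in> Sig M" "b \<in> Sig M" "joins u a b"
  shows "peierls M lam A a b = ereal (u b - u a)"
  using assms joins_iff_peierls_le sub_action_le_peierls by (meson order_antisym)

text \<open>The two barriers are bounded below by \<open>u b - u a\<close> and
  \<open>u a - u b\<close>. These bounds add up to zero, so a vanishing sum forces equality in
  both.\<close>

lemma peierls_sum_zero_joins:
  assumes "sub_action M lam A u" "a \<in> Sig M" "b \<in> Sig M"
    "peierls M lam A a b + peierls M lam A b a = 0"
  shows "peierls M lam A a b = ereal (u b - u a)" "joins u a b"
proof -
  show "peierls M lam A a b = ereal (u b - u a)"
    using sub_action_le_peierls[OF assms(1-3)] sub_action_le_peierls[OF assms(1,3,2)] assms(4)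
    by (cases "peierls M lam A a b"; cases "peierls M lam A b a") auto
  then show "joins u a b" by (simp add: joins_iff_peierls_le)
qed

text \<open>For fixed \<open>N\<close> and \<open>e\<close>, a late pair \<open>a n\<close>,
  \<open>b n\<close> agrees with the limits on \<open>N\<close> symbols, and its difference of
  \<open>u\<close> is within \<open>e / 2\<close> of the limiting one. A path for that pair then
  serves the limits.\<close>

lemma joins_limit:
  assumes u: "sub_action M lam A u" and G: "\<And>n. joins u (a n) (b n)"
    and S: "\<And>n. a n \<in> Sig M" "\<And>n. b n \<in> Sig M"
    and lim: "tends_seq a a'" "tends_seq b b'"
  shows "joins u a' b'"
  unfolding joins_def
proof (intro allI impI)
  fix e :: real and N :: nat
  assume e: "0 < e"
  have cont: "continuous_map (top_Sig M lam) euclideanreal u" using u by (simp add: sub_action_def)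
  have "(\<lambda>n. u (b n) - u (a n)) \<longlonglongrightarrow> u b' - u a'"
    by (intro tendsto_diff continuous_tends_seq[OF cont] S lim)
  then have "\<forall>\<^sub>F n in sequentially. u (b n) - u (a n) < u b' - u a' + e / 2"
    by (rule order_tendstoD) (use e in simp)
  moreover have "\<forall>\<^sub>F n in sequentially. agree N (a n) a'" "\<forall>\<^sub>F n in sequentially. agree N (b n) b'"
    using lim by (auto simp: tends_seq_def)
  ultimately have "\<forall>\<^sub>F n in sequentially. u (b n) - u (a n) < u b' - u a' + e / 2 \<and>
      agree N (a n) a' \<and> agree N (b n) b'"
    by eventually_elim auto
  then obtain n where n: "u (b n) - u (a n) < u b' - u a' + e / 2"
    "agree N (a n) a'" "agree N (b n) b'"
    by (auto simp: eventually_sequentially)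
  obtain k z where z: "N \<le> k" "is_path M k z" "agree N (snd (z 0)) (a n)"
    "agree N (snd (z k)) (b n)" "path_cost M lam A k z < u (b n) - u (a n) + e / 2"
    using joinsD[OF G, of "e / 2"] e by (metis half_gt_zero)
  have "path_cost M lam A k z < u b' - u a' + e" using z(5) n(1) by linarith
  then show "\<exists>k\<ge>N. \<exists>z. is_path M k z \<and> agree N (snd (z 0)) a' \<and>
        agree N (snd (z k)) b' \<and> path_cost M lam A k z < u b' - u a' + e"
    using z n agree_trans by blast
qed

text \<open>
  The point \<open>snd (z' 0)\<close> need not equal the end \<open>snd (z k)\<close> of the first path, so the points of
  the first path are moved: they keep the symbols prepended along \<open>z\<close>, but are continued by
  \<open>snd (z' 0)\<close>.
\<close>

definition splice :: "nat \<Rightarrow> (nat \<Rightarrow> (nat \<Rightarrow> 's) \<times> (nat \<Rightarrow> 's)) \<Rightarrow> (nat \<Rightarrow> (nat \<Rightarrow> 's) \<times> (nat \<Rightarrow> 's))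
    \<Rightarrow> nat \<Rightarrow> (nat \<Rightarrow> 's) \<times> (nat \<Rightarrow> 's)" where
  "splice k z z' i =
     (if i \<le> k then (fst (z i), \<lambda>j. if j < k - i then snd (z i) j else snd (z' 0) (j - (k - i)))
      else z' (i - k))"

text \<open>At index \<open>i\<close> the \<open>k - i\<close> prepended symbols are kept and the
  \<open>N\<close> symbols common to the two junction points follow. The agreement thus lengthens
  away from the junction, which makes the total error a geometric series.\<close>

lemma splice_agree:
  assumes "is_path M k z" "agree N (snd (z k)) (snd (z' 0))" "i \<le> k"
  shows "agree (k - i + N) (snd (splice k z z' i)) (snd (z i))"
  unfolding agree_def
proof (intro allI impI)
  fix j assume j: "j < k - i + N"
  show "snd (splice k z z' i) j = snd (z i) j"
  proof (cases "j < k - i")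
    case False
    then have "snd (z i) j = snd (z k) (j - (k - i))"
      using is_path_shift[OF assms(1), of i "k - i" "j - (k - i)"] assms(3) by simp
    also have "\<dots> = snd (z' 0) (j - (k - i))" using assms(2) j False by (auto simp: agree_def)
    finally show ?thesis using False assms(3) by (simp add: splice_def)
  qed (use assms(3) in \<open>simp add: splice_def\<close>)
qed

lemma splice_tail: "i \<ge> k \<Longrightarrow> snd (splice k z z' i) = snd (z' (i - k))"
  by (auto simp: splice_def)

text \<open>Two adjacent symbols either both lie in the prefix copied from \<open>z i\<close> or are
  both read from \<open>snd (z' 0)\<close>, because the two ranges overlap in
  \<open>N \<ge> 1\<close> symbols. The overlap also keeps the first symbol at \<open>i = k\<close>,
  so the dual part stays admissible.\<close>

lemma splice_in_Sig_hat:
  assumes p: "is_path M k z" and p': "is_path M k' z'"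
    and ag: "agree N (snd (z k)) (snd (z' 0))" "N \<ge> 1" and i: "i \<le> k"
  shows "splice k z z' i \<in> Sig_hat M"
proof -
  let ?x = "snd (splice k z z' i)"
  note a = splice_agree[of k z N z' i, OF p ag(1) i]
  have zi: "z i \<in> Sig_hat M" using p i by (simp add: is_path_def)
  have "?x 0 = snd (z i) 0" using a ag(2) by (simp add: agree_def)
  moreover have "M $ ?x j $ ?x (Suc j) = 1" for j
  proof (cases "Suc j < k - i + N")
    case True
    then have "?x j = snd (z i) j" "?x (Suc j) = snd (z i) (Suc j)" using a by (auto simp: agree_def)
    then show ?thesis using is_path_in_Sig[OF p i] by (simp add: Sig_def)
  next
    case False
    then have "?x j = snd (z' 0) (j - (k - i))" "?x (Suc j) = snd (z' 0) (Suc (j - (k - i)))"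
      using i ag(2) by (auto simp: splice_def Suc_diff_le)
    then show ?thesis using is_path_in_Sig[OF p', of 0] by (simp add: Sig_def)
  qed
  ultimately show ?thesis
    using zi i by (auto simp: Sig_hat_def Sig_dual_at_def Sig_def splice_def)
qed

lemma is_path_splice:
  assumes p: "is_path M k z" and p': "is_path M k' z'"
    and ag: "agree N (snd (z k)) (snd (z' 0))" "N \<ge> 1"
  shows "is_path M (k + k') (splice k z z')"
  unfolding is_path_def
proof (intro conjI allI impI)
  fix i assume i: "i \<le> k + k'"
  show "splice k z z' i \<in> Sig_hat M"
  proof (cases "i \<le> k")
    case False
    then show ?thesis using p' i by (simp add: splice_def is_path_def)
  qed (rule splice_in_Sig_hat[OF p p' ag])
next
  fix i assume i: "i < k + k'"
  show "snd (splice k z z' i) = tau (fst (splice k z z' (Suc i))) (snd (splice k z z' (Suc i)))"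
  proof (cases "i < k")
    case True
    then obtain d where k: "k = Suc (i + d)" using less_imp_Suc_add by blast
    have zi: "snd (z i) = tau (fst (z (Suc i))) (snd (z (Suc i)))"
      using p True by (simp add: is_path_def)
    show ?thesis
    proof
      fix j
      show "snd (splice k z z' i) j =
          tau (fst (splice k z z' (Suc i))) (snd (splice k z z' (Suc i))) j"
        using zi by (cases j) (auto simp: splice_def tau_def k)
    qed
  next
    \<comment> \<open>At \<open>i = k\<close> the dual part still comes from \<open>z k\<close>, but
      the link to the next index involves only the second component, which is
      \<open>snd (z' 0)\<close>.\<close>
    case False
    then have "snd (z' (i - k)) = tau (fst (z' (Suc (i - k)))) (snd (z' (Suc (i - k))))"
      using p' i by (simp add: is_path_def)
    then show ?thesis using False splice_tail[of k i z z'] by (simp add: splice_def Suc_diff_le)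
  qed
qed

end


section \<open>Hoelder bounds for spliced paths and transitivity of \<open>joins\<close>\<close>

locale holder_setting = observable +
  fixes K \<alpha> :: real
  assumes \<alpha>_pos: "0 < \<alpha>"
    and K_nonneg: "0 \<le> K"
    and A_holder: "\<And>z z'. z \<in> Sig_hat M \<Longrightarrow> z' \<in> Sig_hat M \<Longrightarrow>
      \<bar>A z - A z'\<bar> \<le> K * dist_hat lam z z' powr \<alpha>"
begin

lemma A_diff_le:
  assumes "z \<in> Sig_hat M" "z' \<in> Sig_hat M" "fst z = fst z'" "agree n (snd z) (snd z')"
  shows "\<bar>A z - A z'\<bar> \<le> K * (lam powr \<alpha>) ^ n"
proof -
  have nn: "0 \<le> dist_seq lam (snd z) (snd z')" by (rule nonneg)
  then have "dist_hat lam z z' = dist_seq lam (snd z) (snd z')"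
    using assms(3) by (simp add: dist_hat_def dist_dual_def)
  also have "\<dots> \<le> lam ^ n" by (rule dist_seq_le_power[OF lam_pos lam_less assms(4)])
  finally have "dist_hat lam z z' powr \<alpha> \<le> (lam ^ n) powr \<alpha>"
    using \<alpha>_pos nn by (intro powr_mono2) (auto simp: dist_hat_def le_max_iff_disj)
  also have "\<dots> = (lam powr \<alpha>) ^ n"
    using lam_pos by (simp add: powr_powr mult.commute flip: powr_realpow)
  finally show ?thesis
    using A_holder[OF assms(1,2)] K_nonneg by (meson mult_left_mono order_trans)
qed

text \<open>Moving the point at index \<open>i\<close> changes \<open>A\<close> by at most
  \<open>K * t ^ (k - i + N)\<close> with \<open>t = lam powr \<alpha>\<close>. The sum over
  \<open>i\<close> is dominated by a geometric series, so the error is independent of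
  \<open>k\<close> and vanishes as \<open>N\<close> grows.\<close>

lemma splice_cost:
  assumes p: "is_path M k z" and p': "is_path M k' z'"
    and ag: "agree N (snd (z k)) (snd (z' 0))" "N \<ge> 1"
  shows "path_cost M lam A (k + k') (splice k z z') \<le>
    path_cost M lam A k z + path_cost M lam A k' z'
      + K * (lam powr \<alpha>) ^ N / (1 - lam powr \<alpha>)"
proof -
  define t where "t = lam powr \<alpha>"
  have t: "0 < t" "t < 1"
    using lam_pos lam_less \<alpha>_pos powr_less_mono2[of \<alpha> lam 1] by (auto simp: t_def)
  let ?B = "\<lambda>z. A z - min_value M lam A"
  have "path_cost M lam A (k + k') (splice k z z') =
      (\<Sum>i=1..k. ?B (splice k z z' i)) + (\<Sum>i=k+1..k+k'. ?B (splice k z z' i))"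
    unfolding path_cost_def by (rule sum.ub_add_nat) simp
  \<comment> \<open>Costs start at index 1, so \<open>z' 0\<close> contributes nothing and the
    junction is charged once, at index \<open>k\<close>.\<close>
  also have "(\<Sum>i=k+1..k+k'. ?B (splice k z z' i)) = path_cost M lam A k' z'"
    unfolding path_cost_def
    by (rule sum.reindex_bij_witness[of _ "\<lambda>i. i + k" "\<lambda>i. i - k"]) (auto simp: splice_def)
  also have "(\<Sum>i=1..k. ?B (splice k z z' i)) \<le> (\<Sum>i=1..k. ?B (z i) + K * t ^ N * t ^ (k - i))"
  proof (rule sum_mono)
    fix i assume i: "i \<in> {1..k}"
    then have ik: "i \<le> k" by simp
    have "\<bar>A (splice k z z' i) - A (z i)\<bar> \<le> K * t ^ (k - i + N)"
      unfolding t_def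
      by (rule A_diff_le[OF splice_in_Sig_hat[OF p p' ag ik] _ _ splice_agree[of k z N z' i, OF p ag(1) ik]])
        (use p ik in \<open>auto simp: is_path_def splice_def\<close>)
    then show "?B (splice k z z' i) \<le> ?B (z i) + K * t ^ N * t ^ (k - i)"
      by (simp add: power_add mult_ac)
  qed
  also have "\<dots> = path_cost M lam A k z + K * t ^ N * (\<Sum>i=1..k. t ^ (k - i))"
    by (simp add: path_cost_def sum.distrib sum_distrib_left)
  also have "(\<Sum>i=1..k. t ^ (k - i)) = (\<Sum>i<k. t ^ i)"
    by (rule sum.reindex_bij_witness[of _ "\<lambda>i. k - i" "\<lambda>i. k - i"]) auto
  also have "\<dots> \<le> (\<Sum>i. t ^ i)" using t by (intro sum_le_suminf summable_geometric) auto
  also have "\<dots> = 1 / (1 - t)" using t by (intro suminf_geometric) auto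
  finally show ?thesis
    using K_nonneg t by (simp add: t_def mult_left_mono)
qed

text \<open>Two paths with near-optimal costs are spliced at \<open>b\<close>. The agreement
  \<open>n\<close> there is chosen before the paths, which is possible because the splicing error
  does not depend on their lengths.\<close>

lemma joins_trans:
  assumes "joins u a b" "joins u b c"
  shows "joins u a c"
  unfolding joins_def
proof (intro allI impI)
  fix e :: real and N :: nat
  assume e: "0 < e"
  define t where "t = lam powr \<alpha>"
  have t: "0 < t" "t < 1"
    using lam_pos lam_less \<alpha>_pos powr_less_mono2[of \<alpha> lam 1] by (auto simp: t_def)
  have "(\<lambda>n. K * t ^ n / (1 - t)) \<longlonglongrightarrow> K * 0 / (1 - t)"
    using t by (intro tendsto_intros LIMSEQ_realpow_zero) auto
  then have "\<forall>\<^sub>F n in sequentially. K * t ^ n / (1 - t) < e / 3"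
    by (rule order_tendstoD) (use e in simp)
  moreover have "\<forall>\<^sub>F n in sequentially. n \<ge> max N 1" by (rule eventually_ge_at_top)
  ultimately have "\<forall>\<^sub>F n in sequentially. K * t ^ n / (1 - t) < e / 3 \<and> n \<ge> max N 1"
    by eventually_elim simp
  then obtain n where n: "K * t ^ n / (1 - t) < e / 3" "n \<ge> max N 1"
    by (auto simp: eventually_sequentially)
  have e3: "0 < e / 3" using e by simp
  obtain k z where z: "n \<le> k" "is_path M k z" "agree n (snd (z 0)) a"
    "agree n (snd (z k)) b" "path_cost M lam A k z < u b - u a + e / 3"
    using joinsD[OF assms(1) e3] by blast
  obtain k' z' where z': "n \<le> k'" "is_path M k' z'" "agree n (snd (z' 0)) b"
    "agree n (snd (z' k')) c" "path_cost M lam A k' z' < u c - u b + e / 3"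
    using joinsD[OF assms(2) e3] by blast
  have ag: "agree n (snd (z k)) (snd (z' 0))" using z(4) z'(3) agree_sym agree_trans by blast
  let ?w = "splice k z z'"
  have "agree n (snd (?w 0)) (snd (z 0))"
    using splice_agree[of k z n z' 0, OF z(2) ag] by (rule_tac agree_mono) auto
  then have "agree N (snd (?w 0)) a" using z(3) n(2) by (meson agree_mono agree_trans max.boundedE)
  moreover have "agree N (snd (?w (k + k'))) c"
    using z'(4) n(2) splice_tail[of k "k + k'" z z'] by (auto elim!: agree_mono)
  moreover have "path_cost M lam A (k + k') ?w < u c - u a + e"
    using splice_cost[OF z(2) z'(2) ag] n z(5) z'(5) unfolding t_def by linarith
  ultimately show "\<exists>k\<ge>N. \<exists>z. is_path M k z \<and> agree N (snd (z 0)) a \<and>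
        agree N (snd (z k)) c \<and> path_cost M lam A k z < u c - u a + e"
    using is_path_splice[OF z(2) z'(2) ag] n(2) z(1) by (intro exI[of _ "k + k'"]) auto
qed

end


section \<open>Calibrated backward orbits\<close>

context observable
begin

text \<open>The orbit \<open>X\<close> follows preimages that attain the minimum in the calibration
  identity, and \<open>p\<close> is one of its accumulation points.\<close>

lemma calibrated_backward_orbit:
  assumes u: "calibrated_sub_action M lam A u" and v: "sub_action M lam A v" and x: "x \<in> Sig M"
  obtains p where "p \<in> nonwandering M lam A" "joins u p x" "u p - v p \<le> u x - v x"
proof -
  have su: "sub_action M lam A u" using u by (simp add: calibrated_sub_action_def)
  have cont: "continuous_map (top_Sig M lam) euclideanreal u"
    "continuous_map (top_Sig M lam) euclideanreal v"
    using su v by (auto simp: sub_action_def)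
  let ?B = "\<lambda>z. A z - min_value M lam A"
  have "\<exists>y. (y, x) \<in> Sig_hat M \<and> u x = u (tau y x) + ?B (y, x)" if "x \<in> Sig M" for x
  proof -
    have "u x \<in> (\<lambda>y. u (tau y x) + A (y, x) - min_value M lam A) ` Sig_dual_at M x"
      using u that by (simp add: calibrated_sub_action_def has_min_on_def)
    then show ?thesis using that by (auto simp: Sig_hat_def)
  qed
  then obtain f where f: "\<And>x. x \<in> Sig M \<Longrightarrow> (f x, x) \<in> Sig_hat M"
    "\<And>x. x \<in> Sig M \<Longrightarrow> u x = u (tau (f x) x) + ?B (f x, x)"
    by metis
  define X where "X n = ((\<lambda>x. tau (f x) x) ^^ n) x" for n
  have X0: "X 0 = x" and XS: "X (Suc n) = tau (f (X n)) (X n)" for n by (auto simp: X_def)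
  have X: "X n \<in> Sig M" for n by (induction n) (simp_all add: X0 x XS tau_in_Sig f(1))
  \<comment> \<open>Path indices run against the orbit: index 0 is the deepest preimage
    \<open>X (m + k)\<close> and index \<open>k\<close> is \<open>X m\<close>. Calibration gives
    equality at each step, so the cost telescopes exactly.\<close>
  have path: "is_path M k (\<lambda>i. (f (X (m + k - i)), X (m + k - i)))" (is "is_path M k ?z")
    and cost: "path_cost M lam A k (\<lambda>i. (f (X (m + k - i)), X (m + k - i))) = u (X m) - u (X (m + k))"
    for m k
  proof -
    show "is_path M k ?z" unfolding is_path_def
    proof (intro conjI allI impI)
      fix i assume "i < k"
      then have "m + k - i = Suc (m + k - Suc i)" by simp
      then show "snd (?z i) = tau (fst (?z (Suc i))) (snd (?z (Suc i)))" by (simp add: XS)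
    qed (simp add: X f(1))
    have "path_cost M lam A k ?z = (\<Sum>i<k. ?B (f (X (m + i)), X (m + i)))"
      unfolding path_cost_def
      by (rule sum.reindex_bij_witness[of _ "\<lambda>i. k - i" "\<lambda>i. k - i"]) auto
    also have "\<dots> = (\<Sum>i<k. u (X (m + i)) - u (X (m + Suc i)))"
    proof (rule sum.cong)
      show "?B (f (X (m + i)), X (m + i)) = u (X (m + i)) - u (X (m + Suc i))" for i
        using f(2)[OF X, of "m + i"] by (simp add: XS)
    qed simp
    also have "\<dots> = u (X m) - u (X (m + k))"
      using sum_lessThan_telescope'[of "\<lambda>i. u (X (m + i))" k] by simp
    finally show "path_cost M lam A k ?z = u (X m) - u (X (m + k))" .
  qed
  \<comment> \<open>One backward step lowers \<open>u\<close> by exactly its cost and lowers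
    \<open>v\<close> by at most that cost.\<close>
  have dec: "u (X n) - v (X n) \<le> u x - v x" for n
  proof (induction n)
    case (Suc n)
    have "v (X n) - v (X (Suc n)) \<le> ?B (f (X n), X n)"
      using v f(1)[OF X] unfolding sub_action_def XS by fastforce
    then show ?case using Suc f(2)[OF X, of n] by (simp add: XS)
  qed (simp add: X0)
  obtain r p where r: "strict_mono (r::nat\<Rightarrow>nat)" and p: "tends_seq (\<lambda>n. X (r n)) p"
    by (rule convergent_subsequence)
  have pS: "p \<in> Sig M" by (rule Sig_closed[OF X p])
  have ulim: "(\<lambda>n. u (X (r n))) \<longlonglongrightarrow> u p" by (rule continuous_tends_seq[OF cont(1) X p])
  have vlim: "(\<lambda>n. v (X (r n))) \<longlonglongrightarrow> v p" by (rule continuous_tends_seq[OF cont(2) X p])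
  show thesis
  proof (rule that)
    show "u p - v p \<le> u x - v x"
      by (rule LIMSEQ_le_const2[OF tendsto_diff[OF ulim vlim]]) (use dec in blast)
    \<comment> \<open>The segment from \<open>X (r n)\<close> to \<open>x\<close> has length
      \<open>r n\<close> and cost \<open>u x - u (X (r n))\<close>, which tends to
      \<open>u x - u p\<close>.\<close>
    show "joins u p x"
      unfolding joins_def
    proof (intro allI impI)
      fix e :: real and N :: nat
      assume "0 < e"
      then have "\<forall>\<^sub>F n in sequentially. u p - e < u (X (r n))" using order_tendstoD(1)[OF ulim] by simp
      moreover have "\<forall>\<^sub>F n in sequentially. agree N (X (r n)) p" using p by (simp add: tends_seq_def)
      moreover have "\<forall>\<^sub>F n in sequentially. n \<ge> N" by (rule eventually_ge_at_top)
      ultimately have "\<forall>\<^sub>F n in sequentially. u p - e < u (X (r n)) \<and> agree N (X (r n)) p \<and> n \<ge> N"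
        by eventually_elim auto
      then obtain n where n: "u p - e < u (X (r n))" "agree N (X (r n)) p" "n \<ge> N"
        by (auto simp: eventually_sequentially)
      have "N \<le> r n" using strict_mono_imp_increasing[OF r, of n] n(3) by linarith
      then show "\<exists>k\<ge>N. \<exists>z. is_path M k z \<and> agree N (snd (z 0)) p \<and>
          agree N (snd (z k)) x \<and> path_cost M lam A k z < u x - u p + e"
        using path[of "r n" 0] cost[of "r n" 0] n
        by (intro exI[of _ "r n"] conjI exI[of _ "\<lambda>i. (f (X (0 + r n - i)), X (0 + r n - i))"])
          (auto simp: X0 agree_def)
    qed
    \<comment> \<open>The segment between two consecutive visits near \<open>p\<close>, at times
      \<open>r n\<close> and \<open>r (Suc n)\<close>, costs the difference of two values of
      \<open>u\<close> close to \<open>u p\<close>.\<close>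
    show "p \<in> nonwandering M lam A"
      unfolding nonwandering_def
    proof (intro CollectI conjI allI impI)
      fix e :: real assume e: "0 < e"
      then obtain N where N: "\<And>x y :: nat \<Rightarrow> 's. agree N x y \<Longrightarrow> dist_seq lam x y < e"
        using dist_seq_less_ex_agree[OF lam_pos lam_less] by blast
      have "\<forall>\<^sub>F n in sequentially. dist (u (X (r n))) (u p) < e / 2"
        using tendstoD[OF ulim, of "e / 2"] e by simp
      moreover have "\<forall>\<^sub>F n in sequentially. agree N (X (r n)) p" using p by (simp add: tends_seq_def)
      ultimately have "\<forall>\<^sub>F n in sequentially. dist (u (X (r n))) (u p) < e / 2 \<and> agree N (X (r n)) p"
        by eventually_elim auto
      then obtain n where n: "\<And>m. m \<ge> n \<Longrightarrow> dist (u (X (r m))) (u p) < e / 2"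
        "\<And>m. m \<ge> n \<Longrightarrow> agree N (X (r m)) p"
        by (auto simp: eventually_sequentially)
      define k where "k = r (Suc n) - r n"
      have k: "k \<ge> 1" "r n + k = r (Suc n)"
        using strict_monoD[OF r, of n "Suc n"] by (auto simp: k_def)
      let ?z = "\<lambda>i. (f (X (r n + k - i)), X (r n + k - i))"
      have "dist_seq lam (snd (?z 0)) p < e" "dist_seq lam (snd (?z k)) p < e"
        using N[OF n(2)[of n]] N[OF n(2)[of "Suc n"]] by (simp_all flip: k(2))
      then have "?z \<in> paths M lam k p p e" using path[of k "r n"] unfolding paths_def by blast
      moreover have "\<bar>path_cost M lam A k ?z\<bar> < e"
        unfolding cost unfolding k(2) using n(1)[of n] n(1)[of "Suc n"] unfolding dist_real_def by linarith
      ultimately show "\<exists>k\<ge>1. \<exists>z\<in>paths M lam k p p e. \<bar>path_cost M lam A k z\<bar> < e"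
        using k(1) by blast
    qed (rule pS)
  qed
qed

section \<open>Irreducible components and minima of the difference of sub-actions\<close>

lemma component_joins:
  assumes u: "sub_action M lam A u" and C: "C \<in> irreducible_components M lam A"
  obtains c where "\<And>a. a \<in> C \<Longrightarrow> joins u a c" "\<And>a. a \<in> C \<Longrightarrow> joins u c a"
proof -
  \<comment> \<open>A class is the image of a representative \<open>c\<close> under the relation, so
    the vanishing sum is available directly for pairs containing \<open>c\<close>. Arbitrary pairs
    are reached through \<open>c\<close> in \<open>component_joins_all\<close>.\<close>
  from C obtain c where c: "c \<in> nonwandering M lam A" and
    C: "\<And>a. a \<in> C \<Longrightarrow> a \<in> nonwandering M lam A \<and> peierls M lam A c a + peierls M lam A a c = 0"
    by (auto simp: irreducible_components_def elim!: quotientE)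
  show thesis
  proof (rule that)
    fix a assume "a \<in> C"
    then have "c \<in> Sig M" "a \<in> Sig M" "peierls M lam A c a + peierls M lam A a c = 0"
      using c C by (auto simp: nonwandering_def)
    then show "joins u c a" "joins u a c"
      using peierls_sum_zero_joins(2)[OF u, of c a] peierls_sum_zero_joins(2)[OF u, of a c]
      by (auto simp: add.commute)
  qed
qed

lemma component_diff_constant:
  assumes u: "sub_action M lam A u" and v: "sub_action M lam A v"
    and C: "C \<in> irreducible_components M lam A"
  shows "(\<lambda>x. u x - v x) constant_on C"
proof -
  from C obtain c where c: "c \<in> nonwandering M lam A" and
    C: "\<And>a. a \<in> C \<Longrightarrow> a \<in> nonwandering M lam A \<and> peierls M lam A c a + peierls M lam A a c = 0"
    by (auto simp: irreducible_components_def elim!: quotientE)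
  have "u a - v a = u c - v c" if "a \<in> C" for a
  proof -
    have s: "c \<in> Sig M" "a \<in> Sig M" "peierls M lam A c a + peierls M lam A a c = 0"
      using c C[OF that] by (auto simp: nonwandering_def)
    have "ereal (u a - u c) = ereal (v a - v c)"
      using peierls_sum_zero_joins(1)[OF u s] peierls_sum_zero_joins(1)[OF v s] by simp
    then show ?thesis by simp
  qed
  then show ?thesis unfolding constant_on_def by blast
qed

text \<open>Compactness gives a minimizer on \<open>Sig M\<close>, and its backward orbit
  accumulates at a non-wandering point where the difference is no larger.\<close>

lemma min_diff_on_nonwandering:
  assumes u: "calibrated_sub_action M lam A u" and v: "sub_action M lam A v" and ne: "Sig M \<noteq> {}"
  shows "\<exists>m. has_min_on (\<lambda>x. u x - v x) (Sig M) m \<and>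
           has_min_on (\<lambda>x. u x - v x) (nonwandering M lam A) m"
proof -
  have "continuous_map (top_Sig M lam) euclideanreal (\<lambda>x. u x - v x)"
    using u v by (intro continuous_map_diff) (auto simp: sub_action_def calibrated_sub_action_def)
  then obtain x where x: "x \<in> Sig M" "\<And>y. y \<in> Sig M \<Longrightarrow> u x - v x \<le> u y - v y"
    using continuous_attains_min[OF _ ne] by blast
  obtain p where p: "p \<in> nonwandering M lam A" "u p - v p \<le> u x - v x"
    using calibrated_backward_orbit[OF u v x(1)] by blast
  have sub: "nonwandering M lam A \<subseteq> Sig M" by (auto simp: nonwandering_def)
  then have "u p - v p = u x - v x" using p x(2) by (meson order_antisym subsetD)
  then have "\<forall>y\<in>Sig M. u p - v p \<le> u y - v y" using x(2) by simp
  then have "has_min_on (\<lambda>x. u x - v x) (Sig M) (u p - v p)"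
    "has_min_on (\<lambda>x. u x - v x) (nonwandering M lam A) (u p - v p)"
    using p(1) sub unfolding has_min_on_def by blast+
  then show ?thesis by blast
qed

text \<open>The hypothesis is applied to the union of the balls of radius \<open>lam ^ n\<close>
  centred in \<open>C\<close>. The points \<open>q n\<close> approach the set \<open>C\<close> and
  possibly no single point of it, so each is paired with its own nearby \<open>c n\<close>.\<close>

lemma not_local_min_sequence:
  assumes nl: "not_local_min M lam w C" and C: "C \<subseteq> Sig M"
  obtains q c where "\<And>n. q n \<in> Sig M" "\<And>n. c n \<in> C" "\<And>n. agree n (q n) (c n)"
    "\<And>n a. a \<in> C \<Longrightarrow> w (q n) < w a"
proof -
  have "\<exists>q\<in>Sig M. \<exists>c\<in>C. agree n q c \<and> (\<forall>a\<in>C. w q < w a)" for n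
  proof -
    define U where "U = (\<Union>c\<in>C. mball c (lam ^ n))"
    have "openin (top_Sig M lam) U" unfolding U_def top_Sig_def by auto
    moreover have "C \<subseteq> U" unfolding U_def using C lam_pos by fastforce
    ultimately obtain q where q: "q \<in> U" "\<forall>a\<in>C. w q < w a"
      using nl unfolding not_local_min_def by blast
    from q(1) obtain c where c: "c \<in> C" "q \<in> Sig M" "dist_seq lam c q < lam ^ n"
      by (auto simp: U_def)
    then have "agree n q c"
      by (auto simp: dist_seq_less_power_iff[OF lam_pos lam_less] intro: agree_sym elim!: agree_mono)
    with c q(2) show ?thesis by blast
  qed
  then have "\<exists>q c. \<forall>n. q n \<in> Sig M \<and> c n \<in> C \<and> agree n (q n) (c n) \<and> (\<forall>a\<in>C. w (q n) < w a)"
    by metis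
  then show thesis using that by blast
qed

end

section \<open>Propagation from the minimizing component to all of \<open>Sig M\<close>\<close>

context holder_setting
begin

lemma component_joins_all:
  assumes "sub_action M lam A u" "C \<in> irreducible_components M lam A" "a \<in> C" "b \<in> C"
  shows "joins u a b"
  using component_joins[OF assms(1,2)] joins_trans assms(3,4) by metis

text \<open>
  Among the points of the non-wandering set that are not joined from \<open>xbar\<close>, take one, \<open>p\<close>, with
  the least value of \<open>u - v\<close>.  Since its component is not a local minimum, points \<open>q n\<close> with a smaller value
  accumulate at the component, and the backward orbits of the \<open>q n\<close> end at non-wandering
  points with a still smaller value, which are joined from \<open>xbar\<close>.  Hence so are the \<open>q n\<close>, their
  limit, and finally \<open>p\<close>.
\<close>

lemma joins_from_minimizing_component:
  assumes u: "calibrated_sub_action M lam A u" and v: "sub_action M lam A v"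
    and fin: "finite \<C>" and cover: "nonwandering M lam A = \<Union>\<C>"
    and comp: "\<C> \<subseteq> irreducible_components M lam A"
    and C1: "C1 \<in> \<C>" "xbar \<in> C1"
    and nl: "\<And>C. C \<in> \<C> \<Longrightarrow> C \<noteq> C1 \<Longrightarrow> not_local_min M lam (\<lambda>x. u x - v x) C"
    and x: "x \<in> Sig M"
  shows "joins u xbar x"
proof -
  have su: "sub_action M lam A u" using u by (simp add: calibrated_sub_action_def)
  define w where "w = (\<lambda>x. u x - v x)"
  have sub: "nonwandering M lam A \<subseteq> Sig M" by (auto simp: nonwandering_def)
  define D where "D = {p \<in> nonwandering M lam A. \<not> joins u xbar p}"
  have "D = {}"
  proof (rule ccontr)
    assume ne: "D \<noteq> {}"
    \<comment> \<open>The least value on \<open>D\<close> exists because \<open>w\<close> is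
      constant on each of finitely many components.\<close>
    have "finite (w ` C)" if C: "C \<in> \<C>" for C
    proof -
      have "w constant_on C"
        using component_diff_constant[OF su v, of C] comp C unfolding w_def by blast
      then obtain y where "w ` C \<subseteq> {y}" unfolding constant_on_def by blast
      then show ?thesis by (rule finite_subset) simp
    qed
    then have "finite (w ` \<Union>\<C>)" using fin by (simp add: image_Union)
    moreover have "D \<subseteq> \<Union>\<C>" by (auto simp: D_def cover)
    ultimately have finD: "finite (w ` D)" by (meson finite_subset image_mono)
    then have "Min (w ` D) \<in> w ` D" using ne by (intro Min_in) auto
    then obtain p where p: "p \<in> D" "w p = Min (w ` D)" by auto
    have min: "w p \<le> w p'" if "p' \<in> D" for p' using finD that p(2) by simp
    obtain C where C: "C \<in> \<C>" "p \<in> C" using p(1) cover by (auto simp: D_def)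
    have Cc: "C \<in> irreducible_components M lam A" using C(1) comp by blast
    \<comment> \<open>All points of \<open>C1\<close> are joined from \<open>xbar\<close>, whereas
      \<open>p\<close> is not.\<close>
    have "C \<noteq> C1"
      using p(1) component_joins_all[OF su Cc _ C(2)] C1 by (auto simp: D_def)
    then have "not_local_min M lam w C" unfolding w_def by (rule nl[OF C(1)])
    moreover have CS: "C \<subseteq> Sig M" using C(1) cover sub by blast
    ultimately obtain q c where q: "\<And>n. q n \<in> Sig M" "\<And>n. c n \<in> C" "\<And>n. agree n (q n) (c n)"
      "\<And>n a. a \<in> C \<Longrightarrow> w (q n) < w a"
      by (rule not_local_min_sequence) blast
    have Gq: "joins u xbar (q n)" for n
    proof -
      obtain p' where p': "p' \<in> nonwandering M lam A" "joins u p' (q n)" "w p' \<le> w (q n)"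
        using calibrated_backward_orbit[OF u v q(1), of n] unfolding w_def by blast
      then have "w p' < w p" using q(4)[OF C(2), of n] by linarith
      then have "joins u xbar p'" using min p'(1) by (auto simp: D_def not_le[symmetric])
      then show ?thesis using p'(2) joins_trans by blast
    qed
    \<comment> \<open>The limit \<open>l\<close> is not claimed to lie in \<open>C\<close>. It
      connects the two halves: \<open>xbar\<close> is joined to \<open>q (r n)\<close>, hence to
      \<open>l\<close>, and \<open>c (r n)\<close> is joined to \<open>p\<close>, hence so is
      \<open>l\<close>.\<close>
    obtain r l where r: "strict_mono (r::nat\<Rightarrow>nat)" and l: "tends_seq (\<lambda>n. c (r n)) l"
      by (rule convergent_subsequence)
    have ql: "tends_seq (\<lambda>n. q (r n)) l"
      unfolding tends_seq_def
    proof
      fix N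
      have "\<forall>\<^sub>F n in sequentially. agree N (c (r n)) l" using l by (simp add: tends_seq_def)
      moreover have "\<forall>\<^sub>F n in sequentially. n \<ge> N" by (rule eventually_ge_at_top)
      ultimately show "\<forall>\<^sub>F n in sequentially. agree N (q (r n)) l"
      proof eventually_elim
        case (elim n)
        have "N \<le> r n" using strict_mono_imp_increasing[OF r, of n] elim(2) by linarith
        then have "agree N (q (r n)) (c (r n))" using q(3) agree_mono by blast
        then show ?case using elim(1) agree_trans by blast
      qed
    qed
    have const: "tends_seq (\<lambda>n. a) a" for a :: "nat \<Rightarrow> 's" by (simp add: tends_seq_def agree_def)
    have cS: "c n \<in> Sig M" for n using q(2) CS by blast
    have xS: "xbar \<in> Sig M" and pS: "p \<in> Sig M"
      using C1 cover sub CS C(2) by auto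
    have "joins u xbar l"
      by (rule joins_limit[OF su Gq xS q(1) const ql])
    moreover have "joins u l p"
      by (rule joins_limit[OF su component_joins_all[OF su Cc q(2) C(2)] cS pS l const])
    ultimately have "joins u xbar p" by (rule joins_trans)
    with p(1) show False by (simp add: D_def)
  qed
  \<comment> \<open>An arbitrary \<open>x\<close> is reached through the non-wandering point at
    which its backward orbit accumulates.\<close>
  moreover obtain p where "p \<in> nonwandering M lam A" "joins u p x"
    using calibrated_backward_orbit[OF u v x] by blast
  ultimately show ?thesis using joins_trans unfolding D_def by blast
qed

end

theorem mainTheorem3:
  fixes M :: "real^'s^'s"
    and lam :: real
    and A :: "(nat \<Rightarrow> 's) \<times> (nat \<Rightarrow> 's) \<Rightarrow> real"
    and u v :: "(nat \<Rightarrow> 's) \<Rightarrow> real"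
  assumes "transition_matrix M" and "irreducible_matrix M"
    and "0 < lam" and "lam < 1"
    and "holder_observable M lam A"
    and "sub_action M lam A v"
    and "calibrated_sub_action M lam A u"
  shows
    "((\<forall>C\<in>irreducible_components M lam A. (\<lambda>x. u x - v x) constant_on C) \<and>
      (\<exists>m. has_min_on (\<lambda>x. u x - v x) (Sig M) m \<and>
           has_min_on (\<lambda>x. u x - v x) (nonwandering M lam A) m)) \<and>
     (\<forall>(r::nat) (C :: nat \<Rightarrow> (nat \<Rightarrow> 's) set) i1.
        nonwandering M lam A = (\<Union>i\<in>{1..r}. C i) \<and>
        disjoint_family_on C {1..r} \<and>
        (\<forall>i\<in>{1..r}. C i \<in> irreducible_components M lam A) \<and>
        i1 \<in> {1..r} \<and>
        (\<forall>i\<in>{1..r}. (\<exists>x\<in>C i. has_min_on (\<lambda>x. u x - v x) (Sig M) (u x - v x)) \<longleftrightarrow> i = i1) \<and>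
        (\<forall>i\<in>{1..r} - {i1}. not_local_min M lam (\<lambda>x. u x - v x) (C i))
        \<longrightarrow> (\<forall>xbar\<in>C i1. \<forall>x\<in>Sig M. ereal (u x) = ereal (u xbar) + peierls M lam A xbar x))"
proof -
  obtain K \<alpha> where K: "0 < \<alpha>" "\<And>z z'. z \<in> Sig_hat M \<Longrightarrow> z' \<in> Sig_hat M \<Longrightarrow>
      \<bar>A z - A z'\<bar> \<le> K * dist_hat lam z z' powr \<alpha>"
    using assms(5) unfolding holder_observable_def by blast
  \<comment> \<open>\<open>holder_observable\<close> does not fix the sign of its constant, so
    \<open>K\<close> is replaced by \<open>max K 0\<close>.\<close>
  interpret holder_setting M lam A "max K 0" \<alpha>
  proof
    fix z z' assume z: "z \<in> Sig_hat M" "z' \<in> Sig_hat M"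
    have "K * dist_hat lam z z' powr \<alpha> \<le> max K 0 * dist_hat lam z z' powr \<alpha>"
      by (intro mult_right_mono) auto
    then show "\<bar>A z - A z'\<bar> \<le> max K 0 * dist_hat lam z z' powr \<alpha>" using K(2)[OF z] by linarith
  qed (use assms K in auto)
  have su: "sub_action M lam A u" using assms(7) by (simp add: calibrated_sub_action_def)
  show ?thesis
  proof (intro conjI allI impI ballI)
    show "(\<lambda>x. u x - v x) constant_on C" if "C \<in> irreducible_components M lam A" for C
      by (rule component_diff_constant[OF su assms(6) that])
    show "\<exists>m. has_min_on (\<lambda>x. u x - v x) (Sig M) m \<and>
           has_min_on (\<lambda>x. u x - v x) (nonwandering M lam A) m"
      by (rule min_diff_on_nonwandering[OF assms(7,6) Sig_nonempty[OF assms(1,2)]])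
  next
    fix r :: nat and C :: "nat \<Rightarrow> (nat \<Rightarrow> 's) set" and i1 xbar x
    assume H: "nonwandering M lam A = (\<Union>i\<in>{1..r}. C i) \<and>
        disjoint_family_on C {1..r} \<and>
        (\<forall>i\<in>{1..r}. C i \<in> irreducible_components M lam A) \<and>
        i1 \<in> {1..r} \<and>
        (\<forall>i\<in>{1..r}. (\<exists>x\<in>C i. has_min_on (\<lambda>x. u x - v x) (Sig M) (u x - v x)) \<longleftrightarrow> i = i1) \<and>
        (\<forall>i\<in>{1..r} - {i1}. not_local_min M lam (\<lambda>x. u x - v x) (C i))"
      and xb: "xbar \<in> C i1" and x: "x \<in> Sig M"
    have xS: "xbar \<in> Sig M" using H xb by (force simp: nonwandering_def)
    have "joins u xbar x"
    proof (rule joins_from_minimizing_component[OF assms(7,6), of "C ` {1..r}" "C i1"])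
      show "not_local_min M lam (\<lambda>x. u x - v x) C'" if "C' \<in> C ` {1..r}" "C' \<noteq> C i1" for C'
        using that H by blast
    qed (use H xb x in auto)
    then have "peierls M lam A xbar x = ereal (u x - u xbar)"
      by (rule joins_peierls_eq[OF su xS x])
    then show "ereal (u x) = ereal (u xbar) + peierls M lam A xbar x" by simp
  qed
qed

end
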